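(* For every integer $k\ge 3$, $T_k(k+3)=k+5$. Moreover, up to isomorphism the only extremal graphs (triangle-free graphs on $k+4$ vertices containing no $k$-sparse set of $k+3$ vertices) are the complete bipartite graph $K_{2,k+2}$ and the graph obtained from $K_{2,k+2}$ by deleting one edge.
   Context: All graphs are finite and simple. A set $S$ of vertices of a graph $G$ is $k$-sparse if the induced subgraph $G[S]$ has maximum degree at most $k$. For integers $k\ge0$ and $j\ge1$, $T_k(j)$ denotes the minimum $n$ such that every triangle-free graph on $n$ vertices contains a $k$-sparse set of $j$ vertices. An extremal graph for $T_k(j)$ is a triangle-free graph on $T_k(j)-1$ vertices containing no $k$-sparse set of $j$ vertices. *)

theory Defs
  imports "Graph_Theory.Graph_Theory"
begin

text \<open>
  A finite simple graph is a \<^locale>\<open>pair_graph\<close>: a finite, symmetric, loop-free set of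
  pairs of vertices, each undirected edge being present in both orientations. Hence
  \<^const>\<open>out_degree\<close> is the usual degree.
\<close>

text \<open>Triangle vertices are automatically distinct, as a \<^locale>\<open>pair_graph\<close> has no loops.\<close>

definition triangle_free :: "'a pair_pre_digraph \<Rightarrow> bool" where
  "triangle_free G \<longleftrightarrow>
    \<not> (\<exists>u v w. (u, v) \<in> parcs G \<and> (v, w) \<in> parcs G \<and> (u, w) \<in> parcs G)"

definition sparse_set :: "nat \<Rightarrow> 'a pair_pre_digraph \<Rightarrow> 'a set \<Rightarrow> bool" where
  "sparse_set k G S \<longleftrightarrow>
    S \<subseteq> pverts G \<and> (\<forall>v \<in> S. out_degree (with_proj G \<restriction> S) v \<le> k)"

definition has_sparse_set :: "nat \<Rightarrow> nat \<Rightarrow> 'a pair_pre_digraph \<Rightarrow> bool" where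
  "has_sparse_set k j G \<longleftrightarrow> (\<exists>S. sparse_set k G S \<and> card S = j)"

text \<open>
  The number $T_k(j)$. Quantifying over graphs whose vertices are natural numbers loses
  nothing: every finite graph is isomorphic to one of these.
\<close>

definition sparse_T :: "nat \<Rightarrow> nat \<Rightarrow> nat" where
  "sparse_T k j = (LEAST n. \<forall>G :: nat pair_pre_digraph.
     pair_graph G \<and> triangle_free G \<and> card (pverts G) = n \<longrightarrow> has_sparse_set k j G)"

text \<open>For $j \ge 1$ the truncated subtraction is harmless, because then $T_k(j) \ge 1$.\<close>

definition extremal_graph :: "nat \<Rightarrow> nat \<Rightarrow> 'a pair_pre_digraph \<Rightarrow> bool" where
  "extremal_graph k j G \<longleftrightarrow>
     pair_graph G \<and> triangle_free G \<and> card (pverts G) = sparse_T k j - 1 \<and>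
     \<not> has_sparse_set k j G"

definition graph_iso :: "'a pair_pre_digraph \<Rightarrow> 'b pair_pre_digraph \<Rightarrow> bool" where
  "graph_iso G H \<longleftrightarrow> digraph_iso (with_proj G) (with_proj H)"

definition complete_bipartite :: "nat \<Rightarrow> nat \<Rightarrow> (nat + nat) pair_pre_digraph" where
  "complete_bipartite m n =
    (let U = Inl ` {..<m}; V = Inr ` {..<n}
     in \<lparr> pverts = U \<union> V, parcs = U \<times> V \<union> V \<times> U \<rparr>)"

definition delete_edge :: "'a \<times> 'a \<Rightarrow> 'a pair_pre_digraph \<Rightarrow> 'a pair_pre_digraph" where
  "delete_edge e G = G \<lparr> parcs := parcs G - {e, prod.swap e} \<rparr>"

lemma complete_bipartite_digraph_complete_bipartite:
  "complete_bipartite_digraph m n (with_proj (complete_bipartite m n))"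
  unfolding complete_bipartite_digraph_pair_def complete_bipartite_def Let_def
  by (intro conjI exI[of _ "Inl ` {..<m}"] exI[of _ "Inr ` {..<n}"])
     (auto simp: card_image)

lemma pair_graph_delete_edge:
  assumes "pair_graph G"
  shows "pair_graph (delete_edge e G)"
proof -
  interpret pair_graph G by fact
  show ?thesis
    by unfold_locales
      (auto simp: delete_edge_def symmetric_def sym_def prod.swap_def
        intro: arcs_symmetric wellformed' dest: no_loops' simp: pair_finite_verts pair_finite_arcs)
qed

lemma sparse_set_iff:
  "sparse_set k G S \<longleftrightarrow>
    S \<subseteq> pverts G \<and> (\<forall>v \<in> S. card {u \<in> S. (v, u) \<in> parcs G} \<le> k)"
proof -
  have "out_degree (with_proj G \<restriction> S) v = card {u \<in> S. (v, u) \<in> parcs G}" if "v \<in> S" for v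
  proof -
    have "out_arcs (with_proj G \<restriction> S) v = Pair v ` {u \<in> S. (v, u) \<in> parcs G}"
      using that by (auto simp: out_arcs_def)
    then show ?thesis by (simp add: out_degree_def card_image inj_on_def)
  qed
  then show ?thesis by (auto simp: sparse_set_def)
qed

lemma graph_iso_iff:
  assumes "pair_graph G" and "pair_graph H"
  shows "graph_iso G H \<longleftrightarrow>
    (\<exists>f. bij_betw f (pverts G) (pverts H) \<and>
      (\<forall>u \<in> pverts G. \<forall>v \<in> pverts G. (f u, f v) \<in> parcs H \<longleftrightarrow> (u, v) \<in> parcs G))"
  (is "_ \<longleftrightarrow> ?R")
proof
  interpret G: pair_graph G by fact
  assume "graph_iso G H"
  then obtain h where iso: "pre_digraph.digraph_isomorphism (with_proj G) h"
    and H: "with_proj H = app_iso h (with_proj G)"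
    by (auto simp: graph_iso_def digraph_iso_def)
  from H have vH: "pverts H = iso_verts h ` pverts G" and aH: "parcs H = iso_arcs h ` parcs G"
    and tl: "iso_tail h = fst" and hd: "iso_head h = snd"
    by (auto simp: with_proj_def app_iso_def)
  have inj: "inj_on (iso_verts h) (pverts G)"
    and map: "\<And>u v. (u, v) \<in> parcs G \<Longrightarrow> iso_arcs h (u, v) = (iso_verts h u, iso_verts h v)"
    using iso tl hd by (auto simp: pre_digraph.digraph_isomorphism_def prod_eq_iff)
  have "parcs H = (\<lambda>(u, v). (iso_verts h u, iso_verts h v)) ` parcs G"
    unfolding aH by (rule image_cong) (auto simp: map)
  then have "(iso_verts h u, iso_verts h v) \<in> parcs H \<longleftrightarrow> (u, v) \<in> parcs G"
    if "u \<in> pverts G" "v \<in> pverts G" for u v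
    using that inj by (auto dest: inj_onD G.wellformed' intro: rev_image_eqI)
      (metis G.in_arcsD1 G.in_arcsD2 inj_onD)
  with inj vH show ?R by (intro exI[of _ "iso_verts h"]) (auto simp: bij_betw_def)
next
  interpret G: pair_graph G by fact
  interpret H: pair_graph H by fact
  assume ?R
  then obtain f where inj: "inj_on f (pverts G)" and vH: "pverts H = f ` pverts G"
    and e: "\<And>u v. u \<in> pverts G \<Longrightarrow> v \<in> pverts G \<Longrightarrow> (f u, f v) \<in> parcs H \<longleftrightarrow> (u, v) \<in> parcs G"
    by (auto simp: bij_betw_def)
  let ?h = "\<lparr> iso_verts = f, iso_arcs = map_prod f f, iso_head = snd, iso_tail = fst \<rparr>"
  have "parcs H = map_prod f f ` parcs G"
  proof (intro set_eqI iffI)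
    fix a assume a: "a \<in> parcs H"
    then obtain u v where "a = (f u, f v)" "u \<in> pverts G" "v \<in> pverts G"
      using H.wellformed' vH by (cases a) blast
    with a e show "a \<in> map_prod f f ` parcs G" by force
  next
    fix a assume "a \<in> map_prod f f ` parcs G"
    then show "a \<in> parcs H" using e G.wellformed' by auto
  qed
  then have "with_proj H = app_iso ?h (with_proj G)"
    using vH by (simp add: with_proj_def app_iso_def)
  moreover have "inj_on (map_prod f f) (parcs G)"
    by (rule inj_on_subset[OF map_prod_inj_on[OF inj inj]]) (auto dest: G.wellformed')
  then have "pre_digraph.digraph_isomorphism (with_proj G) ?h"
    using inj G.wf_digraph by (auto simp: pre_digraph.digraph_isomorphism_def)
  ultimately show "graph_iso G H" by (auto simp: graph_iso_def digraph_iso_def)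
qed

end

theory Submission
  imports Defs
begin

text \<open>
  Call a vertex big if its degree is at least $k+1$. In a triangle-free graph on $k+4$ vertices
  adjacent vertices have disjoint neighbourhoods, so for $k \ge 3$ the big vertices are pairwise
  nonadjacent. If no $k+3$ vertices form a $k$-sparse set, then after deleting any vertex some
  other vertex still has degree at least $k+1$; this leaves exactly two big vertices, one
  of them adjacent to all the $k+2$ others, and the other one to all but at most one of them.
  A graph on $k+5$ vertices without such a sparse set would have this structure after deletion of
  each vertex. Deleting a vertex and then a big one yields three independent big vertices, and
  deleting a common neighbour of these leaves no vertex of degree $k+2$.
\<close>

section \<open>Structure on k + 4 vertices\<close>

text \<open>A bare relation \<open>E\<close> and a vertex set \<open>V\<close> replace a graph so
  that the result applies to \<open>V - {x}\<close> without forming an induced subgraph. Whether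
  \<open>E b w\<close> holds is left open: the two possibilities are the two extremal
  graphs.\<close>

lemma obtain_almost_complete_bipartite:
  fixes E :: "'a \<Rightarrow> 'a \<Rightarrow> bool" and k :: nat
  assumes tf: "\<not> (\<exists>u v w. E u v \<and> E v w \<and> E u w)"
    and k: "k \<ge> 3" and card_V: "card V = k + 4"
    and dense: "\<forall>S \<subseteq> V. card S = k + 3 \<longrightarrow> (\<exists>v \<in> S. card {u \<in> S. E v u} > k)"
  obtains a b W w where "V = insert a (insert b W)" "a \<noteq> b" "a \<notin> W" "b \<notin> W"
    "finite W" "card W = k + 2" "w \<in> W" "\<not> E a b"
    "\<And>u. u \<in> W \<Longrightarrow> E a u" "\<And>u. u \<in> W - {w} \<Longrightarrow> E b u"
    "\<And>u v. u \<in> W \<Longrightarrow> v \<in> W \<Longrightarrow> \<not> E u v"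
proof -
  have fin: "finite V" using card_V by (metis card.infinite add_is_0 zero_neq_numeral)
  define N where "N v = {u \<in> V. E v u}" for v
  define B where "B = {v \<in> V. card (N v) \<ge> k + 1}"
  have N_sub: "N v \<subseteq> V" and fin_N [simp]: "finite (N v)" for v using fin by (auto simp: N_def)
  have key: "\<exists>v \<in> B. v \<noteq> x \<and> card (N v - {x}) \<ge> k + 1" if "x \<in> V" for x
  proof -
    have "card (V - {x}) = k + 3" using that card_V by simp
    then obtain v where v: "v \<in> V - {x}" "card {u \<in> V - {x}. E v u} > k"
      using dense by blast
    moreover have "{u \<in> V - {x}. E v u} = N v - {x}" by (auto simp: N_def)
    ultimately have "card (N v - {x}) \<ge> k + 1" by simp
    moreover from this have "card (N v) \<ge> k + 1"
      using card_mono[of "N v" "N v - {x}"] by fastforce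
    ultimately show ?thesis using v by (auto simp: B_def)
  qed
  have indep: "\<not> E u v" if "u \<in> B" "v \<in> B" for u v
  proof
    assume "E u v"
    then have "N u \<inter> N v = {}" using tf by (auto simp: N_def)
    \<comment> \<open>Disjoint neighbourhoods of size at least k + 1 would give 2k + 2 \<le> k + 4,
      which k \<ge> 3 excludes. The case \<open>u = v\<close> is covered as well, since a loop
      counts as a triangle in \<open>tf\<close>.\<close>
    then have "card (N u) + card (N v) = card (N u \<union> N v)" by (simp add: card_Un_disjoint)
    also have "\<dots> \<le> k + 4" using card_mono[OF fin, of "N u \<union> N v"] N_sub card_V by auto
    finally show False using that k by (simp add: B_def)
  qed
  obtain x where "x \<in> V" using card_V by fastforce
  then obtain y where y: "y \<in> B" using key by blast
  then have "y \<in> V" by (simp add: B_def)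
  then obtain z where z: "z \<in> B" "z \<noteq> y" using key by blast
  then have "z \<in> V" by (simp add: B_def)
  have N_B: "N v \<subseteq> V - B" if "v \<in> B" for v using that indep by (auto simp: N_def)
  \<comment> \<open>A third big vertex would leave only k + 1 vertices outside
    \<open>{y, z, w}\<close>. They would then be the whole neighbourhood of every big vertex, and
    deleting any one of them would bring all big degrees down to k, against
    \<open>key\<close>.\<close>
  have B_eq: "B = {y, z}"
  proof (rule ccontr)
    assume "B \<noteq> {y, z}"
    then obtain w where w: "w \<in> B" "w \<noteq> y" "w \<noteq> z" using y z by blast
    then have "w \<in> V" by (simp add: B_def)
    let ?W = "V - {y, z, w}"
    have card_W: "card ?W = k + 1"
      using card_V w z \<open>y \<in> V\<close> \<open>z \<in> V\<close> \<open>w \<in> V\<close> by (subst card_Diff_subset) auto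
    have N_W: "N v = ?W" if "v \<in> B" for v
    proof (rule card_seteq)
      show "N v \<subseteq> ?W" using N_B[OF that] y z w by auto
      show "card ?W \<le> card (N v)" using that card_W by (simp add: B_def)
    qed (use fin in simp)
    obtain x where x: "x \<in> ?W"
      using card_W by (metis all_not_in_conv card.empty add_is_0 one_neq_zero)
    then obtain v where "v \<in> B" "card (N v - {x}) \<ge> k + 1" using key by blast
    then show False using N_W card_W x fin by (simp del: Diff_insert Diff_iff)
  qed
  let ?W = "V - {y, z}"
  have card_W: "card ?W = k + 2"
    using card_V z \<open>y \<in> V\<close> \<open>z \<in> V\<close> by (subst card_Diff_subset) auto
  have N_W: "N y \<subseteq> ?W" "N z \<subseteq> ?W" using N_B y z B_eq by auto
  \<comment> \<open>Otherwise both neighbourhoods have exactly k + 1 of the k + 2 vertices of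
    \<open>?W\<close>. Since 2(k + 1) > k + 2 they share a vertex, whose deletion leaves both
    degrees at k, against \<open>key\<close>.\<close>
  have "N y = ?W \<or> N z = ?W"
  proof (rule ccontr)
    assume "\<not> ?thesis"
    then have "N y \<subset> ?W" "N z \<subset> ?W" using N_W by auto
    then have "card (N y) < k + 2" "card (N z) < k + 2"
      using psubset_card_mono[of ?W] fin card_W by (metis finite_Diff)+
    then have card_N: "card (N y) = k + 1" "card (N z) = k + 1"
      using y z by (auto simp: B_def)
    have "card (N y \<union> N z) \<le> k + 2" using card_mono[of ?W "N y \<union> N z"] N_W card_W fin by simp
    then have "N y \<inter> N z \<noteq> {}" using card_N k card_Un_disjoint[of "N y" "N z"] by auto
    then obtain x where "x \<in> N y" "x \<in> N z" by blast
    moreover from this have "x \<in> V" using N_sub by auto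
    ultimately show False using key[of x] B_eq card_N by auto
  qed
  then obtain a b where ab: "{a, b} = {y, z}" "N a = ?W" by (metis insert_commute)
  then have ab': "a \<noteq> b" "a \<in> B" "b \<in> B" using z y by (auto simp: doubleton_eq_iff)
  have N_b: "N b \<subseteq> ?W" "card (N b) \<ge> k + 1" using ab' ab N_W by (auto simp: B_def doubleton_eq_iff)
  then have "card (?W - N b) \<le> 1" using card_W by (simp add: card_Diff_subset)
  moreover have "finite (?W - N b)" using fin by simp
  ultimately have eq: "\<forall>u \<in> ?W - N b. \<forall>v \<in> ?W - N b. u = v"
    by (simp only: card_le_Suc0_iff_eq One_nat_def)
  have "?W \<noteq> {}" using card_W by (metis card.empty add_is_0 zero_neq_numeral)
  \<comment> \<open>\<open>w\<close> is the vertex that \<open>b\<close> misses, or an arbitrary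
    vertex of \<open>?W\<close> if \<open>b\<close> misses none.\<close>
  obtain w where w: "w \<in> ?W" "?W - N b \<subseteq> {w}"
  proof (cases "?W - N b = {}")
    case True
    then show thesis using that \<open>?W \<noteq> {}\<close> by blast
  next
    case False
    then obtain w where "w \<in> ?W - N b" by blast
    moreover from this have "?W - N b \<subseteq> {w}" using eq by blast
    ultimately show thesis using that by blast
  qed
  have E_a: "E a u" if "u \<in> ?W" for u using that ab(2) by (auto simp: N_def)
  show thesis
  proof (rule that[of a b ?W w])
    have "V = {y, z} \<union> ?W" using \<open>y \<in> V\<close> \<open>z \<in> V\<close> by blast
    then show "V = insert a (insert b ?W)" using ab(1) by (metis insert_is_Un sup_assoc)
    show "\<not> E u v" if "u \<in> ?W" "v \<in> ?W" for u v using tf E_a that by blast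
    show "E b u" if "u \<in> ?W - {w}" for u using that w by (auto simp: N_def)
  qed (use ab ab' fin card_W w indep E_a in auto)
qed

section \<open>Upper bound: sparse sets in k + 5 vertices\<close>

lemma sparse_subset_exists:
  fixes E :: "'a \<Rightarrow> 'a \<Rightarrow> bool" and k :: nat
  assumes tf: "\<not> (\<exists>u v w. E u v \<and> E v w \<and> E u w)"
    and k: "k \<ge> 3" and card_V: "card V = k + 5"
  shows "\<exists>S \<subseteq> V. card S = k + 3 \<and> (\<forall>v \<in> S. card {u \<in> S. E v u} \<le> k)"
proof (rule ccontr)
  assume "\<not> ?thesis"
  then have dense: "\<forall>S \<subseteq> V - {x}. card S = k + 3 \<longrightarrow> (\<exists>v \<in> S. card {u \<in> S. E v u} > k)"
    for x by (meson Diff_subset not_le subset_trans)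
  have fin: "finite V" using card_V by (metis card.infinite add_is_0 zero_neq_numeral)
  have card_del: "card (V - {x}) = k + 4" if "x \<in> V" for x using that card_V by simp
  note struct = obtain_almost_complete_bipartite[OF tf k card_del dense]
  obtain x where x: "x \<in> V" using card_V by fastforce
  obtain y z W w0 where 1: "V - {x} = insert y (insert z W)" "y \<noteq> z" "y \<notin> W" "z \<notin> W"
    "finite W" "card W = k + 2" "w0 \<in> W" "\<not> E y z" "\<And>u. u \<in> W \<Longrightarrow> E y u"
    "\<And>u. u \<in> W - {w0} \<Longrightarrow> E z u" "\<And>u v. u \<in> W \<Longrightarrow> v \<in> W \<Longrightarrow> \<not> E u v"
    by (rule struct[OF x]) (rule that)
  have y: "y \<in> V" and V: "V = insert x (insert y (insert z W))" and x': "x \<noteq> y" "x \<noteq> z" "x \<notin> W"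
    using 1(1) x by blast+
  obtain a b W' w1 where 2: "V - {y} = insert a (insert b W')" "a \<noteq> b" "a \<notin> W'" "b \<notin> W'"
    "finite W'" "card W' = k + 2" "w1 \<in> W'" "\<not> E a b" "\<And>u. u \<in> W' \<Longrightarrow> E a u"
    "\<And>u. u \<in> W' - {w1} \<Longrightarrow> E b u" "\<And>u v. u \<in> W' \<Longrightarrow> v \<in> W' \<Longrightarrow> \<not> E u v"
    by (rule struct[OF y]) (rule that)
  \<comment> \<open>Outside \<open>y\<close>, a vertex of the independent set \<open>W\<close> can
    only be adjacent to \<open>x\<close> and \<open>z\<close>, whereas \<open>a\<close> and
    \<open>b\<close> have at least k + 1 neighbours there. So the big vertices of
    \<open>V - {y}\<close> are \<open>x\<close> and \<open>z\<close>, and both decompositions have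
    the same independent part.\<close>
  have big: "v \<notin> W" if "\<And>u. u \<in> W' - {w1} \<Longrightarrow> E v u" for v
  proof
    assume v: "v \<in> W"
    have "W' - {w1} \<subseteq> {x, z}"
    proof
      fix u assume u: "u \<in> W' - {w1}"
      then have "u \<in> V - {y}" "E v u" using 2(1) that by auto
      then show "u \<in> {x, z}" using 1(11)[OF v] V by auto
    qed
    then have "card (W' - {w1}) \<le> card {x, z}" by (intro card_mono) auto
    moreover have "card (W' - {w1}) \<ge> k + 1" using 2(5,6) by (simp add: card_Diff_singleton_if)
    moreover have "card {x, z} \<le> 2" by (simp add: card_insert_if)
    ultimately show False using k by simp
  qed
  have "a \<notin> W" "b \<notin> W" using big 2(9,10) by auto
  moreover have "a \<in> V - {y}" "b \<in> V - {y}" using 2(1) by auto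
  ultimately have ab: "{a, b} = {x, z}" using 2(2) V by auto
  have "W' = insert a (insert b W') - {a, b}" using 2(3,4) by auto
  also have "\<dots> = V - {y} - {x, z}" by (simp only: 2(1) ab)
  also have "\<dots> = W" using V x' 1(2-4) by auto
  finally have W': "W' = W" .
  \<comment> \<open>A vertex of \<open>W\<close> other than the two exceptional ones is a common
    neighbour of \<open>x\<close>, \<open>y\<close> and \<open>z\<close>, so no two of these are
    adjacent.\<close>
  have "card {w0, w1} \<le> 2" by (simp add: card_insert_if)
  then have "\<not> W \<subseteq> {w0, w1}" using card_mono[of "{w0, w1}" W] 1(6) k by auto
  then obtain w where w: "w \<in> W" "w \<noteq> w0" "w \<noteq> w1" by blast
  have "E a w" "E b w" using 2(9,10) W' w by auto
  then have "E x w" using ab by (auto simp: doubleton_eq_iff)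
  moreover have "E y w" "E z w" using 1(9,10) w by auto
  ultimately have indep: "\<not> E u v" if "u \<in> {x, y, z}" "v \<in> {x, y, z}" for u v
    using that tf by blast
  \<comment> \<open>Without \<open>w\<close>, a vertex of \<open>W\<close> keeps at most the three
    neighbours \<open>x\<close>, \<open>y\<close>, \<open>z\<close>, and each of these three keeps
    at most the k + 1 vertices of \<open>W - {w}\<close>. The structure of \<open>V - {w}\<close>
    demands a vertex \<open>c\<close> with k + 2 neighbours.\<close>
  have small: "card {u \<in> V - {w}. E v u} \<le> k + 1" if v: "v \<in> V" for v
  proof (cases "v \<in> W")
    case True
    then have "{u \<in> V - {w}. E v u} \<subseteq> {x, y, z}" using V 1(11) by auto
    then have "card {u \<in> V - {w}. E v u} \<le> card {x, y, z}" by (intro card_mono) auto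
    then show ?thesis using 1(2) x' k by simp
  next
    case False
    then have "v \<in> {x, y, z}" using v V by auto
    then have "{u \<in> V - {w}. E v u} \<subseteq> W - {w}" using V indep by auto
    then have "card {u \<in> V - {w}. E v u} \<le> card (W - {w})" using 1(5) by (intro card_mono) auto
    then show ?thesis using 1(5,6) w by simp
  qed
  have "w \<in> V" using w V by simp
  obtain c d U w2 where 3: "V - {w} = insert c (insert d U)" "c \<noteq> d" "c \<notin> U" "d \<notin> U"
    "finite U" "card U = k + 2" "w2 \<in> U" "\<not> E c d" "\<And>u. u \<in> U \<Longrightarrow> E c u"
    "\<And>u. u \<in> U - {w2} \<Longrightarrow> E d u" "\<And>u v. u \<in> U \<Longrightarrow> v \<in> U \<Longrightarrow> \<not> E u v"
    by (rule struct[OF \<open>w \<in> V\<close>]) (rule that)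
  have "U \<subseteq> {u \<in> V - {w}. E c u}" using 3 by auto
  then have "card U \<le> card {u \<in> V - {w}. E c u}" using fin by (intro card_mono) auto
  also have "\<dots> \<le> k + 1" using small 3(1) by blast
  finally show False using 3(6) by simp
qed

section \<open>Lower bound and the value of T\<close>

text \<open>If \<open>S\<close> contains \<open>a\<close>, it contains at least k + 1 vertices of
  \<open>W\<close>, all adjacent to \<open>a\<close>. If not, size forces \<open>S\<close> to be all
  of \<open>insert b W\<close>, and \<open>b\<close> misses at most one vertex of \<open>W\<close>.
  The inequality \<open>card W \<le> k + 2\<close> lets one lemma serve every order below k +
  5.\<close>

lemma almost_complete_bipartite_dense:
  assumes "S \<subseteq> insert a (insert b W)" "card S = k + 3" "finite W" "card W \<le> k + 2" "b \<notin> W"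
    and E_a: "\<And>u. u \<in> W \<Longrightarrow> E a u" and E_b: "\<And>u. u \<in> W - {w} \<Longrightarrow> E b u"
  shows "\<exists>v \<in> S. card {u \<in> S. E v u} > k"
proof -
  have fin: "finite S" using assms by (meson finite.insertI finite_subset)
  show ?thesis
  proof (cases "a \<in> S")
    case True
    have "card {a, b} \<le> 2" by (simp add: card_insert_if)
    then have "k < card (S - {a, b})"
      using assms(2) diff_card_le_card_Diff[of "{a, b}" S] by simp
    also have "\<dots> \<le> card {u \<in> S. E a u}" using assms(1) fin E_a by (intro card_mono) auto
    finally show ?thesis using True by blast
  next
    case False
    then have "S \<subseteq> insert b W" using assms(1) by blast
    then have S: "S = insert b W" using assms by (intro card_seteq) auto
    then have "k < card (W - {w})" using assms by (simp add: card_Diff_singleton_if)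
    also have "\<dots> \<le> card {u \<in> S. E b u}" using S fin E_b by (intro card_mono) auto
    finally show ?thesis using S by blast
  qed
qed

lemma not_has_sparse_set_iff:
  "\<not> has_sparse_set k j G \<longleftrightarrow>
    (\<forall>S \<subseteq> pverts G. card S = j \<longrightarrow> (\<exists>v \<in> S. card {u \<in> S. (v, u) \<in> parcs G} > k))"
  by (auto simp: has_sparse_set_def sparse_set_iff not_le)

lemma sparse_T_eq:
  fixes k :: nat
  assumes "k \<ge> 3"
  shows "sparse_T k (k + 3) = k + 5"
  unfolding sparse_T_def
proof (rule Least_equality, safe)
  fix G :: "nat pair_pre_digraph"
  assume G: "pair_graph G" "triangle_free G" "card (pverts G) = k + 5"
  interpret pair_graph G by fact
  have "\<exists>S \<subseteq> pverts G. card S = k + 3 \<and> (\<forall>v \<in> S. card {u \<in> S. (v, u) \<in> parcs G} \<le> k)"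
    using G assms by (intro sparse_subset_exists) (simp_all add: triangle_free_def)
  then show "has_sparse_set k (k + 3) G" by (auto simp: has_sparse_set_def sparse_set_iff)
next
  fix n
  assume n: "\<forall>G :: nat pair_pre_digraph.
    pair_graph G \<and> triangle_free G \<and> card (pverts G) = n \<longrightarrow> has_sparse_set k (k + 3) G"
  \<comment> \<open>Minimality needs a counterexample for every n < k + 5, not only for k + 4. It is
    the complete bipartite graph with sides \<open>{0, 1}\<close> and \<open>{2..<n}\<close>, cut
    down to \<open>{..<n}\<close> when n < 2. For n < k + 3 there is no \<open>S\<close> to
    consider.\<close>
  define G :: "nat pair_pre_digraph" where
    "G = \<lparr> pverts = {..<n}, parcs = {(u, v). u < n \<and> v < n \<and> (u < 2 \<longleftrightarrow> \<not> v < 2)} \<rparr>"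
  have "parcs G \<subseteq> {..<n} \<times> {..<n}" by (auto simp: G_def)
  then have "finite (parcs G)" by (rule finite_subset) simp
  then have "pair_graph G"
    by unfold_locales (auto simp: G_def symmetric_def sym_def)
  moreover have "triangle_free G" by (auto simp: triangle_free_def G_def)
  moreover have "card (pverts G) = n" by (simp add: G_def)
  ultimately have sparse: "has_sparse_set k (k + 3) G" using n by blast
  show "k + 5 \<le> n"
  proof (rule ccontr)
    assume "\<not> k + 5 \<le> n"
    have "\<exists>v \<in> S. card {u \<in> S. (v, u) \<in> parcs G} > k"
      if S: "S \<subseteq> pverts G" "card S = k + 3" for S
    proof (rule almost_complete_bipartite_dense[where a = 0 and b = 1 and W = "{2..<n}"])
      show "S \<subseteq> insert 0 (insert 1 {2..<n})" using S by (fastforce simp: G_def)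
    qed (use S \<open>\<not> k + 5 \<le> n\<close> in \<open>auto simp: G_def\<close>)
    then show False using sparse not_has_sparse_set_iff by metis
  qed
qed

section \<open>Invariance under isomorphism\<close>

text \<open>\<open>graph_iso_iff\<close> presupposes pair graphs on both sides, but the theorem
  quantifies over arbitrary \<open>G\<close>. An isomorphism supplies well-formedness of
  \<open>G\<close>; finiteness, absence of loops and symmetry are pulled back from \<open>H\<close>,
  using injectivity on vertices and arcs.\<close>

lemma pair_graph_if_graph_iso:
  assumes "graph_iso G H" and "pair_graph H"
  shows "pair_graph G"
proof -
  interpret H: pair_graph H by fact
  obtain h where iso: "pre_digraph.digraph_isomorphism (with_proj G) h"
    and H: "with_proj H = app_iso h (with_proj G)"
    using assms(1) by (auto simp: graph_iso_def digraph_iso_def)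
  from H have vH: "pverts H = iso_verts h ` pverts G" and aH: "parcs H = iso_arcs h ` parcs G"
    and tl: "iso_tail h = fst" and hd: "iso_head h = snd"
    by (auto simp: with_proj_def app_iso_def)
  have inj: "inj_on (iso_verts h) (pverts G)" and inj_a: "inj_on (iso_arcs h) (parcs G)"
    and wf: "wf_digraph (with_proj G)"
    and map: "\<And>u v. (u, v) \<in> parcs G \<Longrightarrow> iso_arcs h (u, v) = (iso_verts h u, iso_verts h v)"
    using iso tl hd by (auto simp: pre_digraph.digraph_isomorphism_def prod_eq_iff)
  have arc: "(iso_verts h u, iso_verts h v) \<in> parcs H" if "(u, v) \<in> parcs G" for u v
    using map[OF that] that aH by (metis imageI)
  have arcs_G: "u \<in> pverts G \<and> v \<in> pverts G" if "(u, v) \<in> parcs G" for u v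
    using wf that by (auto simp: wf_digraph_def)
  show ?thesis
  proof
    show "finite (pverts G)" using inj vH H.pair_finite_verts by (metis finite_imageD)
    show "finite (parcs G)" using inj_a aH H.pair_finite_arcs by (metis finite_imageD)
    show "fst e \<in> pverts G" "snd e \<in> pverts G" if "e \<in> parcs G" for e
      using that arcs_G by (cases e; auto)+
    show "fst e \<noteq> snd e" if "e \<in> parcs G" for e
      using that arc H.no_loops' by (cases e) auto
    have "(v, u) \<in> parcs G" if uv: "(u, v) \<in> parcs G" for u v
    proof -
      have "(iso_verts h v, iso_verts h u) \<in> parcs H" using arc[OF uv] H.arcs_symmetric by blast
      then obtain u' v' where "(v', u') \<in> parcs G"
        "(iso_verts h v, iso_verts h u) = iso_arcs h (v', u')" unfolding aH by auto
      then show ?thesis using map arcs_G uv inj by (metis Pair_inject inj_onD)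
    qed
    then show "symmetric (with_proj G)" by (auto simp: symmetric_def sym_def)
  qed
qed

lemma has_sparse_set_image:
  assumes bij: "bij_betw f (pverts G) (pverts H)"
    and arc: "\<And>u v. u \<in> pverts G \<Longrightarrow> v \<in> pverts G \<Longrightarrow> (f u, f v) \<in> parcs H \<longleftrightarrow> (u, v) \<in> parcs G"
    and "has_sparse_set k j G"
  shows "has_sparse_set k j H"
proof -
  obtain S where S: "S \<subseteq> pverts G" "card S = j"
    and sparse: "\<And>v. v \<in> S \<Longrightarrow> card {u \<in> S. (v, u) \<in> parcs G} \<le> k"
    using assms(3) by (auto simp: has_sparse_set_def sparse_set_iff)
  have inj: "inj_on f S" using bij S by (auto simp: bij_betw_def intro: inj_on_subset)
  have "card {u \<in> f ` S. (f v, u) \<in> parcs H} \<le> k" if v: "v \<in> S" for v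
  proof -
    have "{u \<in> f ` S. (f v, u) \<in> parcs H} = f ` {u \<in> S. (v, u) \<in> parcs G}"
      using arc S v by blast
    then show ?thesis using sparse[OF v] inj
      by (simp add: card_image inj_on_subset)
  qed
  moreover have "f ` S \<subseteq> pverts H" using bij S by (auto simp: bij_betw_def)
  ultimately show ?thesis
    using S card_image[OF inj] unfolding has_sparse_set_def sparse_set_iff by blast
qed

lemma extremal_graph_if_graph_iso:
  assumes iso: "graph_iso G H" and H: "extremal_graph k j H"
  shows "extremal_graph k j G"
proof -
  have "pair_graph H" using H by (simp add: extremal_graph_def)
  with iso have G: "pair_graph G" by (rule pair_graph_if_graph_iso)
  interpret G: pair_graph G by fact
  obtain f where bij: "bij_betw f (pverts G) (pverts H)"
    and arc: "\<And>u v. u \<in> pverts G \<Longrightarrow> v \<in> pverts G \<Longrightarrow> (f u, f v) \<in> parcs H \<longleftrightarrow> (u, v) \<in> parcs G"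
    using iso graph_iso_iff[OF G \<open>pair_graph H\<close>] by blast
  have "triangle_free G"
    using H arc G.wellformed' unfolding extremal_graph_def triangle_free_def by metis
  moreover have "card (pverts G) = card (pverts H)" using bij by (rule bij_betw_same_card)
  ultimately show ?thesis
    using H G has_sparse_set_image[OF bij arc] by (auto simp: extremal_graph_def)
qed

section \<open>The two graphs are extremal\<close>

lemma pverts_complete_bipartite:
  "pverts (complete_bipartite m n) = Inl ` {..<m} \<union> Inr ` {..<n}"
  by (simp add: complete_bipartite_def Let_def)

lemma parcs_complete_bipartite:
  "parcs (complete_bipartite m n) =
    Inl ` {..<m} \<times> Inr ` {..<n} \<union> Inr ` {..<n} \<times> Inl ` {..<m}"
  by (simp add: complete_bipartite_def Let_def)

lemma pair_graph_complete_bipartite: "pair_graph (complete_bipartite m n)"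
  by unfold_locales
    (auto simp: parcs_complete_bipartite pverts_complete_bipartite symmetric_def sym_def)

text \<open>Placing \<open>H\<close> between the two graphs treats both at once: the upper inclusion
  gives triangle-freeness, the lower one gives enough edges to exclude sparse sets.\<close>

lemma extremal_almost_complete_bipartite:
  assumes k: "k \<ge> 3" and H: "pair_graph H" "pverts H = pverts (complete_bipartite 2 (k + 2))"
    and sub: "parcs H \<subseteq> parcs (complete_bipartite 2 (k + 2))"
    and i: "i < 2"
    and sup: "parcs (delete_edge (Inl i, Inr j) (complete_bipartite 2 (k + 2))) \<subseteq> parcs H"
  shows "extremal_graph k (k + 3) H"
proof -
  have "triangle_free H"
    using sub by (auto simp: triangle_free_def parcs_complete_bipartite)
  moreover have "card (pverts H) = k + 4"
    unfolding H(2) pverts_complete_bipartite by (subst card_Un_disjoint) (auto simp: card_image)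
  moreover have "\<exists>v \<in> S. card {u \<in> S. (v, u) \<in> parcs H} > k"
    if S: "S \<subseteq> pverts H" "card S = k + 3" for S
  \<comment> \<open>The endpoint \<open>Inl i\<close> of the possibly missing edge takes the role of
    \<open>b\<close>; \<open>1 - i\<close> is the other index below 2.\<close>
  proof (rule almost_complete_bipartite_dense
      [where a = "Inl (1 - i)" and b = "Inl i" and W = "Inr ` {..<k + 2}" and w = "Inr j"])
    show "S \<subseteq> insert (Inl (1 - i)) (insert (Inl i) (Inr ` {..<k + 2}))"
    proof
      fix s assume "s \<in> S"
      then have "s \<in> Inl ` {..<2} \<union> Inr ` {..<k + 2}"
        using S H(2) pverts_complete_bipartite by blast
      moreover have "m = 1 - i \<or> m = i" if "m < 2" for m using that i by auto
      ultimately show "s \<in> insert (Inl (1 - i)) (insert (Inl i) (Inr ` {..<k + 2}))" by blast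
    qed
    show "(Inl (1 - i), u) \<in> parcs H" if "u \<in> Inr ` {..<k + 2}" for u
    proof -
      have "1 - i \<noteq> i" "1 - i < 2" by arith+
      then have "(Inl (1 - i), u) \<in>
          parcs (delete_edge (Inl i, Inr j) (complete_bipartite 2 (k + 2)))"
        using that by (simp add: delete_edge_def parcs_complete_bipartite)
      then show ?thesis using sup by blast
    qed
    show "(Inl i, u) \<in> parcs H" if u: "u \<in> Inr ` {..<k + 2} - {Inr j}" for u
    proof -
      obtain l where "u = Inr l" "l < k + 2" "l \<noteq> j" using u by blast
      then have "(Inl i, u) \<in> parcs (delete_edge (Inl i, Inr j) (complete_bipartite 2 (k + 2)))"
        using i by (simp add: delete_edge_def parcs_complete_bipartite)
      then show ?thesis using sup by blast
    qed
  qed (use S in \<open>auto simp: card_image\<close>)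
  ultimately show ?thesis
    using H(1) sparse_T_eq[OF k] by (simp add: extremal_graph_def not_has_sparse_set_iff)
qed

section \<open>Uniqueness of the extremal graphs\<close>

text \<open>This serves to number \<open>W\<close> so that the exceptional vertex \<open>w\<close>
  receives the index \<open>j\<close> of the deleted edge.\<close>

lemma bij_betw_pointed:
  assumes "finite A" "finite B" "card A = card B" "a \<in> A" "b \<in> B"
  obtains f where "bij_betw f A B" "f a = b"
proof -
  have "card (A - {a}) = card (B - {b})" using assms by simp
  then obtain g where g: "bij_betw g (A - {a}) (B - {b})"
    using assms finite_same_card_bij by (metis finite_Diff)
  have "bij_betw (g(a := b)) (insert a (A - {a})) (insert b (B - {b}))"
    using g by (auto simp: bij_betw_def inj_on_def)
  then show thesis using assms that by (metis fun_upd_same insert_Diff)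
qed

text \<open>The indices \<open>i\<close> and \<open>j\<close> are arbitrary because the theorem
  allows any edge to be deleted. One bijection handles both outcomes: it sends \<open>b\<close> to
  \<open>Inl i\<close> and \<open>w\<close> to \<open>Inr j\<close>, so the only undetermined edge
  of \<open>G\<close> is matched with the edge that \<open>?D\<close> lacks.\<close>

lemma graph_iso_if_extremal:
  assumes k: "k \<ge> 3" and G: "extremal_graph k (k + 3) G" and i: "i < 2" and j: "j < k + 2"
  shows "graph_iso G (complete_bipartite 2 (k + 2)) \<or>
    graph_iso G (delete_edge (Inl i, Inr j) (complete_bipartite 2 (k + 2)))"
    (is "graph_iso G ?K \<or> graph_iso G ?D")
proof -
  have pg: "pair_graph G" and card_G: "card (pverts G) = k + 4"
    using G sparse_T_eq[OF k] by (auto simp: extremal_graph_def)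
  interpret pair_graph G by fact
  let ?E = "\<lambda>u v. (u, v) \<in> parcs G"
  have tf: "\<not> (\<exists>u v w. ?E u v \<and> ?E v w \<and> ?E u w)"
    using G by (simp add: extremal_graph_def triangle_free_def)
  have dense: "\<forall>S \<subseteq> pverts G. card S = k + 3 \<longrightarrow> (\<exists>v \<in> S. card {u \<in> S. ?E v u} > k)"
    using G by (simp add: extremal_graph_def not_has_sparse_set_iff)
  obtain a b W w where V: "pverts G = insert a (insert b W)" "a \<noteq> b" "a \<notin> W" "b \<notin> W"
    and W: "finite W" "card W = k + 2" "w \<in> W" and E: "\<not> ?E a b"
    "\<And>u. u \<in> W \<Longrightarrow> ?E a u" "\<And>u. u \<in> W - {w} \<Longrightarrow> ?E b u"
    "\<And>u v. u \<in> W \<Longrightarrow> v \<in> W \<Longrightarrow> \<not> ?E u v"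
    by (rule obtain_almost_complete_bipartite[OF tf k card_G dense]) (rule that)
  obtain g where g: "bij_betw g W {..<k + 2}" "g w = j"
    using bij_betw_pointed[of W "{..<k + 2}" w j] W j by auto
  have "1 - i \<noteq> i" "1 - i < 2" by arith+
  moreover have "{..<2} = {1 - i, i}" using i by auto
  ultimately obtain m where i': "m \<noteq> i" "m < 2" "{..<2} = {m, i}" by blast
  define f where "f v = (if v = a then Inl m else if v = b then Inl i else Inr (g v))" for v
  have f: "f a = Inl m" "f b = Inl i" "\<And>v. v \<in> W \<Longrightarrow> f v = Inr (g v)"
    using V by (auto simp: f_def)
  have "f ` W = Inr ` g ` W"
    unfolding image_image using f(3) by (intro image_cong) auto
  then have "f ` W = Inr ` {..<k + 2}" using bij_betw_imp_surj_on[OF g(1)] by simp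
  then have "f ` pverts G = pverts ?K"
    using V(1) f(1,2) i'(3) by (simp add: pverts_complete_bipartite)
  moreover have g_eq: "g u = g v \<longleftrightarrow> u = v" if "u \<in> W" "v \<in> W" for u v
    using g(1) that by (auto simp: bij_betw_def dest: inj_onD)
  have "inj_on f (pverts G)"
    using i' f V g_eq by (auto simp: inj_on_def)
  ultimately have bij: "bij_betw f (pverts G) (pverts ?K)" by (simp add: bij_betw_def)
  have g_less: "g v < k + 2" if "v \<in> W" for v using bij_betwE[OF g(1)] that by auto
  have E_swap: "?E v u \<longleftrightarrow> ?E u v" for u v using arcs_symmetric by blast
  \<comment> \<open>All adjacencies are now fixed except the single truth value
    \<open>?E b w\<close>, which decides between \<open>?K\<close> and \<open>?D\<close>.\<close>
  have E_b: "?E b u \<longleftrightarrow> u \<noteq> w \<or> ?E b w" if "u \<in> W" for u using that E(3) by blast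
  have "\<not> ?E v v" for v using no_loops' by blast
  with E have E': "\<not> ?E a a" "\<not> ?E b b" "\<not> ?E a b" "\<not> ?E b a"
    "\<And>u. u \<in> W \<Longrightarrow> ?E a u" "\<And>u. u \<in> W \<Longrightarrow> ?E u a"
    "\<And>u. u \<in> W \<Longrightarrow> ?E u b \<longleftrightarrow> ?E b u" "\<And>u v. u \<in> W \<Longrightarrow> v \<in> W \<Longrightarrow> \<not> ?E u v"
    using E_swap by blast+
  have in_K: "(Inl m, Inr n) \<in> parcs ?K \<longleftrightarrow> m < 2 \<and> n < k + 2"
    "(Inr n, Inl m) \<in> parcs ?K \<longleftrightarrow> m < 2 \<and> n < k + 2"
    "(Inl m, Inl m') \<notin> parcs ?K" "(Inr n, Inr n') \<notin> parcs ?K" for m m' n n'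
    by (auto simp: parcs_complete_bipartite)
  show ?thesis
  proof (cases "?E b w")
    case True
    have "(f u, f v) \<in> parcs ?K \<longleftrightarrow> ?E u v" if uv: "u \<in> pverts G" "v \<in> pverts G" for u v
      using uv E_b True unfolding V(1)
      by (elim insertE) (simp_all add: f in_K E' g_less i i' del: add_2_eq_Suc')
    then have "graph_iso G ?K"
      using bij unfolding graph_iso_iff[OF pg pair_graph_complete_bipartite] by blast
    then show ?thesis ..
  next
    case False
    have g_j: "g v = j \<longleftrightarrow> v = w" if "v \<in> W" for v using g_eq[OF that W(3)] g(2) by simp
    have in_D: "(u, v) \<in> parcs ?D \<longleftrightarrow>
        (u, v) \<in> parcs ?K \<and> (u, v) \<noteq> (Inl i, Inr j) \<and> (u, v) \<noteq> (Inr j, Inl i)" for u v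
      by (auto simp: delete_edge_def)
    have "(f u, f v) \<in> parcs ?D \<longleftrightarrow> ?E u v" if uv: "u \<in> pverts G" "v \<in> pverts G" for u v
      using uv E_b False unfolding V(1)
      by (elim insertE) (simp_all add: f in_K in_D E' g_less g_j i i' del: add_2_eq_Suc')
    moreover have "pverts ?D = pverts ?K" by (simp add: delete_edge_def)
    ultimately have "graph_iso G ?D"
      using bij
      unfolding graph_iso_iff[OF pg pair_graph_delete_edge[OF pair_graph_complete_bipartite]]
      by auto
    then show ?thesis ..
  qed
qed

theorem theorem3p7:
  fixes k :: nat
  assumes "k \<ge> 3"
  shows "sparse_T k (k + 3) = k + 5 \<and>
    (\<forall>(G :: 'a pair_pre_digraph). \<forall>e \<in> parcs (complete_bipartite 2 (k + 2)).
       extremal_graph k (k + 3) G \<longleftrightarrow>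
         graph_iso G (complete_bipartite 2 (k + 2)) \<or>
         graph_iso G (delete_edge e (complete_bipartite 2 (k + 2))))"
proof (intro conjI allI ballI)
  show "sparse_T k (k + 3) = k + 5" using assms by (rule sparse_T_eq)
  fix G :: "'a pair_pre_digraph" and e
  let ?K = "complete_bipartite 2 (k + 2)"
  assume "e \<in> parcs ?K"
  then obtain i j where ij: "i < 2" "j < k + 2" and "e = (Inl i, Inr j) \<or> e = (Inr j, Inl i)"
    by (auto simp: parcs_complete_bipartite)
  \<comment> \<open>Deletion removes both orientations, so \<open>e\<close> may be assumed to start
    on the side of size two.\<close>
  then have e: "delete_edge e ?K = delete_edge (Inl i, Inr j) ?K"
    by (auto simp: delete_edge_def insert_commute)
  have K: "extremal_graph k (k + 3) ?K"
    using assms ij pair_graph_complete_bipartite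
    by (intro extremal_almost_complete_bipartite[of k _ i j]) (auto simp: delete_edge_def)
  have D: "extremal_graph k (k + 3) (delete_edge e ?K)"
    unfolding e using assms ij pair_graph_complete_bipartite
    by (intro extremal_almost_complete_bipartite[of k _ i j] pair_graph_delete_edge)
      (auto simp: delete_edge_def)
  show "extremal_graph k (k + 3) G \<longleftrightarrow> graph_iso G ?K \<or> graph_iso G (delete_edge e ?K)"
    using graph_iso_if_extremal[OF assms _ ij] extremal_graph_if_graph_iso K D unfolding e by blast
qed

end
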